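(* Let $X$ be a subspace of a Tychonoff space $Y$ such that $X\subseteq Y\subseteq\beta X$. Then the following assertions are equivalent: (i) $C_p(Y)$ and $C_p(X)$ have the same compact subsets; (ii) $C_p^b(Y)$ and $C_p^b(X)$ have the same compact subsets; (iii) $Y\subseteq\kappa X$.
   Context: For a Tychonoff space $X$, $C_p(X)$ is the set $C(X)$ of all continuous real-valued functions on $X$ with the topology of pointwise convergence, and $C_p^b(X)\subseteq C_p(X)$ is the subspace of all bounded continuous functions. $\beta X$ is the Stone–Čech compactification of $X$, and $Y$ carries the subspace topology from $\beta X$. Since $X$ is dense in $Y$, the restriction map $I:C(Y)\to C(X)$, $I(f)=f{\restriction}_X$, is injective, and via $I$ one regards $C(Y)$ as a subset of $C(X)$ (and bounded functions on $Y$ as bounded functions on $X$). "$C_p(Y)$ and $C_p(X)$ have the same compact subsets" means that the family $\{I(K): K \text{ a compact subset of } C_p(Y)\}$ equals the family of all compact subsets of $C_p(X)$; similarly for $C_p^b(Y)$ and $C_p^b(X)$. A Tychonoff space is called a $\kappa$-space if it is homeomorphic to a closed subspace of $C_p(Z)$ for some locally compact (Hausdorff) space $Z$. The $\kappa$-completion $\kappa X$ of $X$ is the intersection of all subspaces of $\beta X$ that contain $X$ and are $\kappa$-spaces. *)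

theory Defs
  imports "HOL-Analysis.Analysis"
begin

definition tychonoff_space :: "'a topology \<Rightarrow> bool" where
  "tychonoff_space X \<longleftrightarrow> completely_regular_space X \<and> Hausdorff_space X"

text \<open>A continuous function on \<open>X\<close> is represented by a HOL function that is \<open>undefined\<close> outside
  \<open>topspace X\<close>; the points of the product topology already have this form.\<close>

definition Cp :: "'a topology \<Rightarrow> ('a \<Rightarrow> real) topology" where
  "Cp X = subtopology (product_topology (\<lambda>_. euclideanreal) (topspace X))
            {f. continuous_map X euclideanreal f}"

definition Cpb :: "'a topology \<Rightarrow> ('a \<Rightarrow> real) topology" where
  "Cpb X = subtopology (Cp X) {f. bounded (f ` topspace X)}"

text \<open>For function spaces \<open>P\<close> over \<open>Y\<close> and \<open>Q\<close> over a dense subspace with point set \<open>S\<close>: the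
  restriction map to \<open>S\<close> carries the family of compact subsets of \<open>P\<close> onto that of \<open>Q\<close>.\<close>

definition same_compact_subsets ::
    "'a set \<Rightarrow> ('a \<Rightarrow> real) topology \<Rightarrow> ('a \<Rightarrow> real) topology \<Rightarrow> bool" where
  "same_compact_subsets S P Q \<longleftrightarrow>
     {(\<lambda>f. restrict f S) ` K | K. compactin P K} = {K. compactin Q K}"

text \<open>\<open>stone_cech B X\<close> says that \<open>B\<close> is \<open>\<beta>X\<close>, with \<open>X\<close> an actual subspace of it: a compact
  Hausdorff space that contains \<open>X\<close> as a dense, \<open>C\<^sup>*\<close>-embedded subspace. Extension of continuous
  maps into arbitrary compact Hausdorff spaces follows, see \<open>stone_cech_extension\<close>, and so \<open>B\<close> is
  unique up to a homeomorphism fixing \<open>X\<close>.\<close>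

definition stone_cech :: "'a topology \<Rightarrow> 'a topology \<Rightarrow> bool" where
  "stone_cech B X \<longleftrightarrow>
     compact_space B \<and> Hausdorff_space B \<and>
     X = subtopology B (topspace X) \<and> B closure_of topspace X = topspace B \<and>
     (\<forall>f. continuous_map X euclideanreal f \<and> bounded (f ` topspace X) \<longrightarrow>
        (\<exists>g. continuous_map B euclideanreal g \<and> (\<forall>x\<in>topspace X. g x = f x)))"

text \<open>The definition cannot quantify over the type of points of \<open>Z\<close>. The type chosen
  here is large enough: \<open>kappa_spaceI\<close> shows that \<open>Z\<close> may have points of any type.\<close>

definition kappa_space :: "'a topology \<Rightarrow> bool" where
  "kappa_space X \<longleftrightarrow> tychonoff_space X \<and>
     (\<exists>(Z :: (('a \<Rightarrow> real) set \<times> ('a \<Rightarrow> real)) topology) C.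
        locally_compact_space Z \<and> Hausdorff_space Z \<and>
        closedin (Cp Z) C \<and> X homeomorphic_space subtopology (Cp Z) C)"

text \<open>The \<open>\<kappa>\<close>-completion of \<open>X\<close>, as a set of points of \<open>B = \<beta>X\<close>.\<close>

definition kappa_completion :: "'a topology \<Rightarrow> 'a topology \<Rightarrow> 'a set" where
  "kappa_completion B X =
     \<Inter> {A. topspace X \<subseteq> A \<and> A \<subseteq> topspace B \<and> kappa_space (subtopology B A)}"

lemma stone_cech_extension:
  fixes K :: "'k topology"
  assumes B: "stone_cech B X" and K: "compact_space K" "Hausdorff_space K"
    and h: "continuous_map X K h"
  shows "\<exists>g. continuous_map B K g \<and> (\<forall>x\<in>topspace X. g x = h x)"
proof -
  have "completely_regular_space K"
    using K by (simp add: compact_Hausdorff_or_regular_imp_normal_space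
        normal_imp_completely_regular_space)
  then obtain J :: "('k \<Rightarrow> real) set" and e
    where e: "embedding_map K (product_topology (\<lambda>f. top_of_set {0..1::real}) J) e"
    using completely_regular_space_cube_embedding K by metis
  define P where "P = product_topology (\<lambda>f::'k\<Rightarrow>real. euclideanreal) J"
  have P: "product_topology (\<lambda>f. top_of_set {0..1::real}) J = subtopology P (PiE J (\<lambda>_. {0..1}))"
    unfolding P_def by (simp add: subtopology_product_topology)
  have eP: "embedding_map K P e" and e01: "e ` topspace K \<subseteq> PiE J (\<lambda>_. {0..1})"
    using e unfolding P embedding_map_in_subtopology by auto
  have ce: "continuous_map K P e"
    using eP continuous_map_in_subtopology homeomorphic_imp_continuous_map
    unfolding embedding_map_def by blast
  have hX: "h x \<in> topspace K" if "x \<in> topspace X" for x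
    using h that by (auto simp: continuous_map_def)
  have "\<exists>g. continuous_map B euclideanreal g \<and> (\<forall>x\<in>topspace X. g x = e (h x) j)" if j: "j \<in> J" for j
  proof -
    have "continuous_map K euclideanreal (\<lambda>x. e x j)"
      using ce j unfolding P_def continuous_map_componentwise by auto
    then have "continuous_map X euclideanreal (\<lambda>x. e (h x) j)"
      using continuous_map_compose[OF h] by (simp add: o_def)
    moreover have "(\<lambda>x. e (h x) j) ` topspace X \<subseteq> {0..1}"
    proof -
      have "e (h x) j \<in> {0..1}" if "x \<in> topspace X" for x
        using e01 hX[OF that] j PiE_mem by blast
      then show ?thesis by blast
    qed
    then have "bounded ((\<lambda>x. e (h x) j) ` topspace X)"
      using bounded_closed_interval bounded_subset by blast
    ultimately show ?thesis
      using B unfolding stone_cech_def by blast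
  qed
  then obtain g where gc: "\<And>j. j \<in> J \<Longrightarrow> continuous_map B euclideanreal (g j)"
    and gx: "\<And>j x. j \<in> J \<Longrightarrow> x \<in> topspace X \<Longrightarrow> g j x = e (h x) j"
    by metis
  define G where "G x = restrict (\<lambda>j. g j x) J" for x
  have G: "continuous_map B P G"
    unfolding P_def continuous_map_componentwise G_def using gc by auto
  have Gh: "G x = e (h x)" if "x \<in> topspace X" for x
  proof
    fix j
    have "e (h x) \<in> extensional J"
      using e01 hX[OF that] unfolding PiE_def by blast
    then show "G x j = e (h x) j"
      using gx that by (auto simp: G_def extensional_def)
  qed
  have "compactin P (e ` topspace K)"
    using K(1) ce image_compactin compact_space_def by blast
  moreover have "Hausdorff_space P"
    unfolding P_def by (simp add: Hausdorff_space_product_topology)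
  ultimately have cl: "closedin P (e ` topspace K)"
    by (rule compactin_imp_closedin[rotated])
  have "G ` topspace B \<subseteq> P closure_of (G ` topspace X)"
    using continuous_map_image_closure_subset[OF G, of "topspace X"] B
    by (simp add: stone_cech_def)
  also have "\<dots> \<subseteq> e ` topspace K"
    using Gh hX cl by (intro closure_of_minimal) auto
  finally have "continuous_map B (subtopology P (e ` topspace K)) G"
    using G by (simp add: continuous_map_in_subtopology image_subset_iff_funcset)
  moreover obtain r where r: "homeomorphic_maps K (subtopology P (e ` topspace K)) e r"
    using eP unfolding embedding_map_def homeomorphic_map_maps by blast
  ultimately have "continuous_map B K (r \<circ> G)"
    using continuous_map_compose unfolding homeomorphic_maps_def by blast
  moreover have "(r \<circ> G) x = h x" if "x \<in> topspace X" for x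
    using r Gh hX that unfolding homeomorphic_maps_def by auto
  ultimately show ?thesis by blast
qed

lemma topspace_Cp: "topspace (Cp X) = {f \<in> extensional (topspace X). continuous_map X euclideanreal f}"
  by (auto simp: Cp_def PiE_def)

lemma Hausdorff_space_Cp: "Hausdorff_space (Cp X)"
  unfolding Cp_def by (simp add: Hausdorff_space_subtopology Hausdorff_space_product_topology)

lemma continuous_map_Cp_eval:
  "x \<in> topspace X \<Longrightarrow> continuous_map (Cp X) euclideanreal (\<lambda>f. f x)"
  unfolding Cp_def by (intro continuous_map_from_subtopology continuous_map_product_projection)

lemma continuous_map_into_Cp:
  assumes "\<And>a. a \<in> topspace A \<Longrightarrow> \<phi> a \<in> topspace (Cp Z)"
    and "\<And>z. z \<in> topspace Z \<Longrightarrow> continuous_map A euclideanreal (\<lambda>a. \<phi> a z)"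
  shows "continuous_map A (Cp Z) \<phi>"
proof -
  have "\<phi> \<in> topspace A \<rightarrow> extensional (topspace Z)" "\<phi> \<in> topspace A \<rightarrow> {f. continuous_map Z euclideanreal f}"
    using assms(1) by (auto simp: topspace_Cp)
  then show ?thesis
    unfolding Cp_def continuous_map_in_subtopology continuous_map_componentwise
    using assms(2) by (auto simp: image_subset_iff_funcset)
qed

lemma limitin_Cp:
  assumes "\<forall>\<^sub>F x in F. \<phi> x \<in> topspace (Cp Z)" "h \<in> topspace (Cp Z)"
    and "\<And>z. z \<in> topspace Z \<Longrightarrow> limitin euclideanreal (\<lambda>x. \<phi> x z) (h z) F"
  shows "limitin (Cp Z) \<phi> h F"
  using assms unfolding Cp_def limitin_subtopology limitin_componentwise
  by (auto simp: PiE_def elim: eventually_mono)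

lemma kappa_spaceI:
  fixes A :: "'a topology" and Z :: "'z topology"
  assumes A: "tychonoff_space A"
    and Z: "locally_compact_space Z" "Hausdorff_space Z"
    and C: "closedin (Cp Z) C" "A homeomorphic_space subtopology (Cp Z) C"
  shows "kappa_space A"
proof -
  \<comment> \<open>\<open>W\<close> is the disjoint sum of all compact subsets of \<open>Cp A\<close>, and \<open>A\<close> embeds into \<open>Cp W\<close> by evaluation.\<close>
  define W where "W = sum_topology (subtopology (Cp A)) {K. compactin (Cp A) K}"
  define ev where "ev a = (\<lambda>w\<in>topspace W. snd w a)" for a
  have tW: "w \<in> topspace W \<longleftrightarrow> compactin (Cp A) (fst w) \<and> snd w \<in> fst w" for w
    using compactin_subset_topspace by (cases w) (fastforce simp: W_def)
  have Wlc: "locally_compact_space W"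
    unfolding W_def
    by (simp add: compact_imp_locally_compact_space compact_space_subtopology locally_compact_space_sum_topology)
  have snd_W: "continuous_map W (Cp A) snd"
    unfolding continuous_map_def
  proof (intro conjI allI impI)
    show "snd \<in> topspace W \<rightarrow> topspace (Cp A)"
      using tW compactin_subset_topspace by blast
    fix U assume U: "openin (Cp A) U"
    have "{f. (K, f) \<in> {w \<in> topspace W. snd w \<in> U}} = U \<inter> K" if "compactin (Cp A) K" for K
      using that tW by auto
    then show "openin W {w \<in> topspace W. snd w \<in> U}"
      using U unfolding W_def openin_sum_topology
      by (auto simp: openin_subtopology)
  qed
  have fst_W: "openin W {w \<in> topspace W. fst w \<in> T}" for T
  proof -
    have "{w \<in> topspace W. fst w \<in> T} = Sigma {K. compactin (Cp A) K} (\<lambda>K. if K \<in> T then topspace (subtopology (Cp A) K) else {})"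
      (is "_ = Sigma _ ?S")
      unfolding W_def by (auto split: if_splits)
    moreover have "openin (subtopology (Cp A) K) (?S K)" for K
      by (simp del: topspace_subtopology)
    ultimately show ?thesis
      unfolding W_def by (simp only: openin_disjoint_union) blast
  qed
  have WH: "Hausdorff_space W"
    unfolding Hausdorff_space_def
  proof (intro allI impI, elim conjE)
    fix v w assume v: "v \<in> topspace W" and w: "w \<in> topspace W" and "v \<noteq> w"
    show "\<exists>U V. openin W U \<and> openin W V \<and> v \<in> U \<and> w \<in> V \<and> disjnt U V"
    proof (cases "fst v = fst w")
      case False
      then show ?thesis
        using v w fst_W[of "{fst v}"] fst_W[of "- {fst v}"]
        by (intro exI[of _ "{u \<in> topspace W. fst u \<in> {fst v}}"] exI[of _ "{u \<in> topspace W. fst u \<in> - {fst v}}"])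
           (auto simp: disjnt_def)
    next
      case True
      then have "snd v \<noteq> snd w"
        using \<open>v \<noteq> w\<close> by (auto simp: prod_eq_iff)
      moreover have "snd v \<in> topspace (Cp A)" "snd w \<in> topspace (Cp A)"
        using v w snd_W by (auto simp: continuous_map_def)
      ultimately obtain U V where UV: "openin (Cp A) U" "openin (Cp A) V" "snd v \<in> U" "snd w \<in> V" "disjnt U V"
        using Hausdorff_space_Cp[of A] unfolding Hausdorff_space_def by meson
      then show ?thesis
        using v w snd_W unfolding continuous_map_def
        by (intro exI[of _ "{u \<in> topspace W. snd u \<in> U}"] exI[of _ "{u \<in> topspace W. snd u \<in> V}"])
           (auto simp: disjnt_def)
    qed
  qed
  have in_W: "({f}, f) \<in> topspace W" if "f \<in> topspace (Cp A)" for f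
    using that tW by simp
  have snd_cont: "continuous_map A euclideanreal (snd w)" if "w \<in> topspace W" for w
    using that snd_W by (auto simp: continuous_map_def[of W] topspace_Cp)
  have ev_in: "ev a \<in> topspace (Cp W)" if a: "a \<in> topspace A" for a
  proof -
    have "continuous_map W euclideanreal (\<lambda>w. snd w a)"
      using continuous_map_compose[OF snd_W continuous_map_Cp_eval[OF a]] by (simp add: o_def)
    then have "continuous_map W euclideanreal (ev a)"
      by (rule continuous_map_eq) (simp add: ev_def)
    then show ?thesis by (simp add: topspace_Cp ev_def)
  qed
  have ev_cont: "continuous_map A (Cp W) ev"
  proof (rule continuous_map_into_Cp[OF ev_in])
    fix w assume "w \<in> topspace W"
    then show "continuous_map A euclideanreal (\<lambda>a. ev a w)"
      using snd_cont by (simp add: ev_def)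
  qed
  obtain \<phi> \<psi> where hm: "homeomorphic_maps A (subtopology (Cp Z) C) \<phi> \<psi>"
    using C(2) unfolding homeomorphic_space_def by blast
  have CC: "C \<subseteq> topspace (Cp Z)" using C(1) by (rule closedin_subset)
  have \<phi>: "continuous_map A (subtopology (Cp Z) C) \<phi>" and \<psi>: "continuous_map (subtopology (Cp Z) C) A \<psi>"
    and \<psi>\<phi>: "\<And>a. a \<in> topspace A \<Longrightarrow> \<psi> (\<phi> a) = a"
    using hm unfolding homeomorphic_maps_def by auto
  have \<phi>C: "\<phi> a \<in> C" if "a \<in> topspace A" for a
    using \<phi> that by (auto simp: continuous_map_in_subtopology)
  define e where "e z = (\<lambda>a\<in>topspace A. \<phi> a z)" for z
  have e_in: "e z \<in> topspace (Cp A)" if z: "z \<in> topspace Z" for z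
  proof -
    have "continuous_map A euclideanreal (\<lambda>a. \<phi> a z)"
      using continuous_map_compose[OF _ continuous_map_Cp_eval[OF z], of A \<phi>] \<phi>
      by (simp add: o_def continuous_map_in_subtopology)
    then have "continuous_map A euclideanreal (e z)"
      by (rule continuous_map_eq) (simp add: e_def)
    then show ?thesis by (simp add: topspace_Cp e_def)
  qed
  have e_cont: "continuous_map Z (Cp A) e"
  proof (rule continuous_map_into_Cp[OF e_in])
    fix a assume a: "a \<in> topspace A"
    then have "continuous_map Z euclideanreal (\<phi> a)"
      using \<phi>C CC by (auto simp: topspace_Cp)
    then show "continuous_map Z euclideanreal (\<lambda>z. e z a)"
      using a by (simp add: e_def)
  qed
  have main: "\<exists>a0\<in>topspace A. limitin A u a0 F \<and> g = ev a0"
    if F: "F \<noteq> bot" and u: "\<forall>\<^sub>F x in F. u x \<in> topspace A" and lim: "limitin (Cp W) (\<lambda>x. ev (u x)) g F"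
    for F :: "(('a \<Rightarrow> real) set \<times> ('a \<Rightarrow> real) \<Rightarrow> real) filter" and u g
  proof -
    have g: "g \<in> topspace (Cp W)"
      using lim by (simp add: limitin_def)
    have limw: "limitin euclideanreal (\<lambda>x. snd w (u x)) (g w) F" if w: "w \<in> topspace W" for w
      using continuous_map_limit[OF continuous_map_Cp_eval[OF w] lim] w by (simp add: o_def ev_def)
    have g_eq: "g v = g w" if "v \<in> topspace W" "w \<in> topspace W" "snd v = snd w" for v w
      using limw[OF that(1)] limw[OF that(2)] F that(3)
      by (metis limitin_Hausdorff_unique Hausdorff_space_euclidean)
    define h where "h = (\<lambda>z\<in>topspace Z. g ({e z}, e z))"
    have hK: "h z = g (K, e z)" if "compactin (Cp A) K" "e z \<in> K" "z \<in> topspace Z" for K z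
      unfolding h_def using that tW e_in in_W by (auto intro!: g_eq)
    have h_loc: "\<exists>U. openin Z U \<and> z \<in> U \<and> continuous_map (subtopology Z U) euclideanreal h"
      if z: "z \<in> topspace Z" for z
    proof -
      from z obtain U Q where UQ: "openin Z U" "compactin Z Q" "z \<in> U" "U \<subseteq> Q"
        using Z(1) unfolding locally_compact_space_def by meson
      define K where "K = e ` Q"
      have K: "compactin (Cp A) K"
        unfolding K_def using UQ(2) e_cont by (rule image_compactin)
      have "continuous_map (subtopology (Cp A) K) W (Pair K)"
        unfolding W_def using K by (intro continuous_map_component_injection) simp
      moreover have "continuous_map (subtopology Z U) (subtopology (Cp A) K) e"
        using e_cont UQ(4) unfolding K_def continuous_map_in_subtopology
        by (auto intro: continuous_map_from_subtopology)
      ultimately have "continuous_map (subtopology Z U) W (Pair K \<circ> e)"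
        by (rule continuous_map_compose[rotated])
      moreover have "continuous_map W euclideanreal g"
        using g by (simp add: topspace_Cp)
      ultimately have "continuous_map (subtopology Z U) euclideanreal (g \<circ> (Pair K \<circ> e))"
        by (rule continuous_map_compose)
      then have "continuous_map (subtopology Z U) euclideanreal h"
        by (rule continuous_map_eq) (use K UQ(4) hK[of K] in \<open>auto simp: K_def\<close>)
      then show ?thesis
        using UQ(1,3) by blast
    qed
    have h_cont: "continuous_map Z euclideanreal h"
      unfolding continuous_map_def
    proof (intro conjI allI impI)
      fix V :: "real set" assume V: "openin euclideanreal V"
      show "openin Z {z \<in> topspace Z. h z \<in> V}"
      proof (subst openin_subopen, intro ballI)
        fix z assume z: "z \<in> {z \<in> topspace Z. h z \<in> V}"
        then obtain U where U: "openin Z U" "z \<in> U" "continuous_map (subtopology Z U) euclideanreal h"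
          using h_loc by blast
        have "openin (subtopology Z U) {z \<in> topspace (subtopology Z U). h z \<in> V}"
          using U(3) V by (rule openin_continuous_map_preimage)
        then have "openin Z {z \<in> topspace (subtopology Z U). h z \<in> V}"
          using U(1) openin_trans_full by blast
        then show "\<exists>T. openin Z T \<and> z \<in> T \<and> T \<subseteq> {z \<in> topspace Z. h z \<in> V}"
          using z U(2) by (intro exI[of _ "{z \<in> topspace (subtopology Z U). h z \<in> V}"]) auto
      qed
    qed simp
    have hC: "h \<in> topspace (Cp Z)"
      using h_cont by (simp add: topspace_Cp h_def)
    have limh: "limitin (Cp Z) (\<lambda>x. \<phi> (u x)) h F"
    proof (rule limitin_Cp[OF _ hC])
      show "\<forall>\<^sub>F x in F. \<phi> (u x) \<in> topspace (Cp Z)"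
        using u by eventually_elim (use \<phi>C CC in blast)
      fix z assume z: "z \<in> topspace Z"
      have "limitin euclideanreal (\<lambda>x. e z (u x)) (h z) F"
        using limw[OF in_W[OF e_in[OF z]]] z by (simp add: h_def)
      moreover have "\<forall>\<^sub>F x in F. e z (u x) = \<phi> (u x) z"
        using u by eventually_elim (simp add: e_def)
      ultimately show "limitin euclideanreal (\<lambda>x. \<phi> (u x) z) (h z) F"
        by (rule limitin_transform_eventually[rotated])
    qed
    have evC: "\<forall>\<^sub>F x in F. \<phi> (u x) \<in> C"
      using u by eventually_elim (rule \<phi>C)
    have "h \<in> C"
      using limh C(1) evC F by (rule limitin_closedin)
    with limh evC have "limitin (subtopology (Cp Z) C) (\<lambda>x. \<phi> (u x)) h F"
      by (simp add: limitin_subtopology)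
    from continuous_map_limit[OF \<psi> this] have "limitin A (\<lambda>x. \<psi> (\<phi> (u x))) (\<psi> h) F"
      by (simp add: o_def)
    moreover have "\<forall>\<^sub>F x in F. \<psi> (\<phi> (u x)) = u x"
      using u by eventually_elim (rule \<psi>\<phi>)
    ultimately have lima: "limitin A u (\<psi> h) F"
      by (rule limitin_transform_eventually[rotated])
    then have "limitin (Cp W) (\<lambda>x. ev (u x)) (ev (\<psi> h)) F"
      using continuous_map_limit[OF ev_cont] by (simp add: o_def)
    then have "g = ev (\<psi> h)"
      using limitin_Hausdorff_unique[OF lim _ F Hausdorff_space_Cp] by simp
    moreover have "\<psi> h \<in> topspace A"
      using lima by (simp add: limitin_def)
    ultimately show ?thesis using lima by blast
  qed
  have ev_inj: "inj_on ev (topspace A)"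
  proof (rule inj_onI)
    fix a b assume ab: "a \<in> topspace A" "b \<in> topspace A" "ev a = ev b"
    have "\<phi> a z = \<phi> b z" if z: "z \<in> topspace Z" for z
    proof -
      have "ev a ({e z}, e z) = ev b ({e z}, e z)"
        using ab by simp
      then show ?thesis
        using in_W[OF e_in[OF z]] ab by (simp add: ev_def e_def)
    qed
    moreover have "\<phi> a \<in> extensional (topspace Z)" "\<phi> b \<in> extensional (topspace Z)"
      using ab \<phi>C CC by (auto simp: topspace_Cp)
    ultimately have "\<phi> a = \<phi> b"
      by (intro extensionalityI)
    then show "a = b"
      using \<psi>\<phi> ab by metis
  qed
  have ev_closed: "closed_map A (Cp W) ev"
    unfolding closed_map_def
  proof (intro allI impI)
    fix S assume S: "closedin A S"
    then have SA: "S \<subseteq> topspace A" by (rule closedin_subset)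
    have "g \<in> ev ` S" if "g \<in> Cp W closure_of (ev ` S)" "g \<notin> ev ` S" for g
    proof -
      define F where "F = atin_within (Cp W) g (ev ` S)"
      define u where "u = inv_into S ev"
      have uS: "u x \<in> S" "ev (u x) = x" if "x \<in> ev ` S" for x
        using that unfolding u_def by (auto simp: inv_into_into f_inv_into_f)
      have gC: "g \<in> topspace (Cp W)"
        using that(1) by (simp add: in_closure_of)
      have F: "F \<noteq> bot"
      proof
        assume "F = bot"
        then have "eventually (\<lambda>_. False) F" by simp
        then have "\<exists>U. openin (Cp W) U \<and> g \<in> U \<and> (\<forall>x\<in>U. \<not> (x \<in> ev ` S \<and> x \<noteq> g))"
          using gC unfolding F_def eventually_atin_within by simp
        then obtain U where U: "openin (Cp W) U" "g \<in> U" "\<forall>x\<in>U. \<not> (x \<in> ev ` S \<and> x \<noteq> g)"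
          by (elim exE conjE)
        have "\<exists>x. x \<in> ev ` S \<and> x \<in> U"
          using that(1) U(1,2) unfolding in_closure_of by (elim conjE allE[of _ U] impE) auto
        then show False using that(2) U(3) by metis
      qed
      have evS: "\<forall>\<^sub>F x in F. x \<in> ev ` S"
        unfolding F_def eventually_atin_within using gC openin_topspace by blast
      have "limitin (Cp W) (\<lambda>x. x) g F"
        unfolding F_def limitin_def eventually_atin_within using gC by blast
      moreover have "\<forall>\<^sub>F x in F. x = ev (u x)"
        using evS by eventually_elim (simp add: uS)
      ultimately have "limitin (Cp W) (\<lambda>x. ev (u x)) g F"
        by (rule limitin_transform_eventually[rotated])
      moreover have uev: "\<forall>\<^sub>F x in F. u x \<in> S"
        using evS by eventually_elim (simp add: uS)
      ultimately obtain a0 where a0: "limitin A u a0 F" "g = ev a0"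
        using main[OF F _ \<open>limitin (Cp W) (\<lambda>x. ev (u x)) g F\<close>] eventually_mono[OF uev, of "\<lambda>x. u x \<in> topspace A"] SA
        by blast
      then have "a0 \<in> S"
        using limitin_closedin[OF _ S uev F] by simp
      then show ?thesis using a0 by blast
    qed
    then have "Cp W closure_of (ev ` S) \<subseteq> ev ` S" by blast
    moreover have "ev ` S \<subseteq> topspace (Cp W)"
      using SA ev_in by blast
    ultimately show "closedin (Cp W) (ev ` S)"
      using closure_of_subset_eq by blast
  qed
  have "embedding_map A (Cp W) ev"
    using ev_cont ev_closed ev_inj by (rule injective_closed_imp_embedding_map)
  then have "A homeomorphic_space subtopology (Cp W) (ev ` topspace A)"
    by (rule embedding_map_imp_homeomorphic_space)
  moreover have "closedin (Cp W) (ev ` topspace A)"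
    using ev_closed unfolding closed_map_def by blast
  ultimately show ?thesis
    unfolding kappa_space_def using A Wlc WH by blast
qed

end

theory Submission
  imports Defs
begin

text \<open>
  For \<open>f \<in> C\<^sub>p\<^sup>b(X)\<close> let \<open>f\<^sup>\<beta>\<close> be its continuous extension to \<open>B = \<beta>X\<close>. The proof rests on an intrinsic
  description of the \<open>\<kappa>\<close>-completion: it is the set \<open>H\<close> (\<open>kappa_hull\<close>) of those \<open>y \<in> B\<close> for which the
  evaluation \<open>f \<mapsto> f\<^sup>\<beta>(y)\<close> is continuous on every compact subset of \<open>C\<^sub>p\<^sup>b(X)\<close>.

  \<^item> \<open>H\<close> lies in the realcompactification of \<open>X\<close>: if \<open>g > 0\<close> on \<open>X\<close> and \<open>g\<^sup>\<beta>(y) = 0\<close>, then the functions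
    \<open>f\<^sub>n = max 0 (1 - n g)\<close> converge pointwise to \<open>0\<close>, so together with \<open>0\<close> they form a compact set, while
    \<open>f\<^sub>n\<^sup>\<beta>(y) = 1\<close> for all \<open>n\<close>. Thus every continuous real function on \<open>X\<close> extends to a real
    function on \<open>H\<close>, namely \<open>tan ((arctan f)\<^sup>\<beta>)\<close>, and \<open>f \<mapsto> tan ((arctan f)\<^sup>\<beta>(y))\<close> is continuous on the
    compact subsets of \<open>C\<^sub>p(X)\<close> (\<open>real_ext_continuous_on_compact\<close>).
  \<^item> \<open>H\<close> is a \<open>\<kappa>\<close>-space (\<open>kappa_space_kappa_hull\<close>): for the disjoint sum \<open>W\<close> of the compact subsets of
    \<open>C\<^sub>p\<^sup>b(X)\<close>, evaluation embeds the compact space \<open>B\<close> into \<open>\<real>\<^sup>W\<close>, and a point is sent into \<open>C\<^sub>p(W)\<close> exactly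
    when it belongs to \<open>H\<close>.
  \<^item> \<open>H\<close> is contained in every \<open>\<kappa>\<close>-space \<open>A\<close> with \<open>X \<subseteq> A \<subseteq> B\<close> (\<open>kappa_hull_subset\<close>): an embedding of \<open>A\<close> as
    a closed subspace of \<open>C\<^sub>p(Z)\<close> restricts to \<open>X\<close> and extends to a continuous map \<open>H \<rightarrow> C\<^sub>p(Z)\<close>, because
    continuity on \<open>Z\<close> can be tested on compact sets. Its values lie in the closed copy of \<open>A\<close>, so it
    gives a continuous map \<open>H \<rightarrow> A \<subseteq> B\<close> that fixes the dense set \<open>X\<close>, that is, the inclusion.

  If \<open>Y \<subseteq> H\<close>, then \<open>f \<mapsto> tan ((arctan f)\<^sup>\<beta>)\<close> carries every compact subset of \<open>C\<^sub>p(X)\<close> to a compact subset of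
  \<open>C\<^sub>p(Y)\<close>. Statement (i) implies (ii) because a function on \<open>Y\<close> is bounded when it is bounded on the dense
  set \<open>X\<close>. If (ii) holds and \<open>K\<close> is compact in \<open>C\<^sub>p\<^sup>b(X)\<close>, then restriction is a continuous bijection, hence
  a homeomorphism, from a compact subset of \<open>C\<^sub>p\<^sup>b(Y)\<close> onto \<open>K\<close>; so evaluation at a point of \<open>Y\<close> is
  continuous on \<open>K\<close>, and \<open>Y \<subseteq> H\<close>.
\<close>

section \<open>Sums of topological spaces\<close>

lemma continuous_map_from_sum_topology:
  assumes "\<And>i. i \<in> I \<Longrightarrow> continuous_map (X i) Y (\<lambda>x. f (i, x))"
  shows "continuous_map (sum_topology X I) Y f"
  unfolding continuous_map_def
proof (intro conjI allI impI)
  show "f \<in> topspace (sum_topology X I) \<rightarrow> topspace Y"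
    using assms by (fastforce simp: continuous_map_def)
  fix U assume "openin Y U"
  then have "openin (X i) {x \<in> topspace (X i). f (i, x) \<in> U}" if "i \<in> I" for i
    using assms[OF that] openin_continuous_map_preimage by blast
  moreover have "{x. (i, x) \<in> {w \<in> topspace (sum_topology X I). f w \<in> U}}
      = {x \<in> topspace (X i). f (i, x) \<in> U}" if "i \<in> I" for i
    using that by auto
  ultimately show "openin (sum_topology X I) {w \<in> topspace (sum_topology X I). f w \<in> U}"
    unfolding openin_sum_topology by auto
qed

lemma Hausdorff_space_sum_topology:
  assumes "\<And>i. i \<in> I \<Longrightarrow> Hausdorff_space (X i)"
  shows "Hausdorff_space (sum_topology X I)"
  unfolding Hausdorff_space_def
proof (intro allI impI, elim conjE)
  fix v w
  assume vw: "v \<in> topspace (sum_topology X I)" "w \<in> topspace (sum_topology X I)" "v \<noteq> w"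
  then obtain i x j y where v: "v = (i, x)" "i \<in> I" "x \<in> topspace (X i)"
    and w: "w = (j, y)" "j \<in> I" "y \<in> topspace (X j)"
    by (cases v; cases w) auto
  have summand: "openin (sum_topology X I) (Pair i ` U)" if "i \<in> I" "openin (X i) U" for i U
    using open_map_component_injection[of i I X] that unfolding open_map_def by blast
  show "\<exists>U V. openin (sum_topology X I) U \<and> openin (sum_topology X I) V \<and> v \<in> U \<and> w \<in> V \<and> disjnt U V"
  proof (cases "i = j")
    case True
    then obtain U V where UV: "openin (X i) U" "openin (X i) V" "x \<in> U" "y \<in> V" "disjnt U V"
      using assms[OF v(2)] v w vw(3) unfolding Hausdorff_space_def by metis
    then have "disjnt (Pair i ` U) (Pair i ` V)"
      by (auto simp: disjnt_def)
    then show ?thesis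
      using UV v w True summand by blast
  next
    case False
    then have "disjnt (Pair i ` topspace (X i)) (Pair j ` topspace (X j))"
      by (auto simp: disjnt_def)
    then show ?thesis
      using v w summand by blast
  qed
qed

section \<open>Bounded functions and their extensions\<close>

lemma topspace_Cpb:
  "topspace (Cpb X) =
     {f \<in> extensional (topspace X). continuous_map X euclideanreal f \<and> bounded (f ` topspace X)}"
  by (auto simp: Cpb_def topspace_Cp)

lemma restrict_in_Cp:
  "continuous_map X euclideanreal f \<Longrightarrow> restrict f (topspace X) \<in> topspace (Cp X)"
  using continuous_map_eq[of X euclideanreal f "restrict f (topspace X)"] by (simp add: topspace_Cp)

lemma restrict_in_Cpb:
  "continuous_map X euclideanreal f \<Longrightarrow> bounded (f ` topspace X) \<Longrightarrow>
    restrict f (topspace X) \<in> topspace (Cpb X)"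
  using restrict_in_Cp[of X f] by (simp add: topspace_Cp topspace_Cpb image_restrict_eq)

lemma continuous_map_Cpb_eval:
  "x \<in> topspace X \<Longrightarrow> continuous_map (Cpb X) euclideanreal (\<lambda>f. f x)"
  unfolding Cpb_def by (intro continuous_map_from_subtopology continuous_map_Cp_eval)

lemma continuous_map_into_Cpb:
  assumes "\<And>a. a \<in> topspace A \<Longrightarrow> \<phi> a \<in> topspace (Cpb Z)"
    and "\<And>z. z \<in> topspace Z \<Longrightarrow> continuous_map A euclideanreal (\<lambda>a. \<phi> a z)"
  shows "continuous_map A (Cpb Z) \<phi>"
  unfolding Cpb_def continuous_map_in_subtopology
  using assms continuous_map_into_Cp[of A \<phi> Z] by (auto simp: topspace_Cp topspace_Cpb)

lemma Hausdorff_space_Cpb: "Hausdorff_space (Cpb X)"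
  unfolding Cpb_def by (simp add: Hausdorff_space_subtopology Hausdorff_space_Cp)

lemma compactin_Cpb: "compactin (Cpb X) K \<longleftrightarrow> compactin (Cp X) K \<and> (\<forall>f\<in>K. bounded (f ` topspace X))"
  unfolding Cpb_def compactin_subtopology by auto

lemma stone_cech_topspace_subset: "stone_cech B X \<Longrightarrow> topspace X \<subseteq> topspace B"
  unfolding stone_cech_def by (metis inf_le1 topspace_subtopology)

text \<open>The extension \<open>f\<^sup>\<beta>\<close> of a bounded continuous function \<open>f\<close> from \<open>X\<close> to \<open>B = \<beta>X\<close>. It is
  unique on \<open>topspace B\<close>; off \<open>topspace B\<close>, and for other \<open>f\<close>, the values are arbitrary.\<close>

definition stone_ext :: "'a topology \<Rightarrow> 'a topology \<Rightarrow> ('a \<Rightarrow> real) \<Rightarrow> 'a \<Rightarrow> real" where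
  "stone_ext B X f = (SOME g. continuous_map B euclideanreal g \<and> (\<forall>x\<in>topspace X. g x = f x))"

lemma
  assumes "stone_cech B X" "f \<in> topspace (Cpb X)"
  shows continuous_map_stone_ext: "continuous_map B euclideanreal (stone_ext B X f)"
    and stone_ext_eq: "x \<in> topspace X \<Longrightarrow> stone_ext B X f x = f x"
proof -
  have "\<exists>g. continuous_map B euclideanreal g \<and> (\<forall>x\<in>topspace X. g x = f x)"
    using assms unfolding stone_cech_def topspace_Cpb by blast
  from someI_ex[OF this]
  show "continuous_map B euclideanreal (stone_ext B X f)"
    and "x \<in> topspace X \<Longrightarrow> stone_ext B X f x = f x"
    unfolding stone_ext_def by blast+
qed

text \<open>Uniqueness holds already for extensions to a set \<open>S\<close> between \<open>X\<close> and \<open>B\<close>, since \<open>X\<close> is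
  dense in \<open>S\<close>.\<close>

lemma stone_ext_unique:
  assumes B: "stone_cech B X" and f: "f \<in> topspace (Cpb X)"
    and S: "topspace X \<subseteq> S" "S \<subseteq> topspace B"
    and g: "continuous_map (subtopology B S) euclideanreal g" "\<And>x. x \<in> topspace X \<Longrightarrow> g x = f x"
    and y: "y \<in> S"
  shows "stone_ext B X f y = g y"
proof (rule forall_in_closure_of_eq[where X = "subtopology B S" and S = "topspace X"])
  show "y \<in> subtopology B S closure_of topspace X"
    using B S y unfolding stone_cech_def closure_of_subtopology
    by (auto simp: inf.absorb2)
  show "continuous_map (subtopology B S) euclideanreal (stone_ext B X f)"
    using continuous_map_stone_ext[OF B f] by (rule continuous_map_from_subtopology)
qed (use g stone_ext_eq[OF B f] in auto)

lemma stone_ext_unique_B: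
  assumes B: "stone_cech B X" and f: "f \<in> topspace (Cpb X)"
    and g: "continuous_map B euclideanreal g" "\<And>x. x \<in> topspace X \<Longrightarrow> g x = f x"
    and y: "y \<in> topspace B"
  shows "stone_ext B X f y = g y"
  using stone_ext_unique[OF B f stone_cech_topspace_subset[OF B] order_refl _ g(2) y] g(1)
  by (simp add: continuous_map_from_subtopology)

lemma stone_ext_nonneg:
  assumes B: "stone_cech B X" and f: "f \<in> topspace (Cpb X)"
    and nonneg: "\<And>x. x \<in> topspace X \<Longrightarrow> 0 \<le> f x" and y: "y \<in> topspace B"
  shows "0 \<le> stone_ext B X f y"
proof -
  have "continuous_map B euclideanreal (\<lambda>x. \<bar>stone_ext B X f x\<bar>)"
    by (intro continuous_map_real_abs continuous_map_stone_ext[OF B f])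
  then have "stone_ext B X f y = \<bar>stone_ext B X f y\<bar>"
    by (rule stone_ext_unique_B[OF B f _ _ y]) (use nonneg stone_ext_eq[OF B f] in simp)
  then show ?thesis by simp
qed

lemma stone_cech_tychonoff:
  assumes "stone_cech B X"
  shows "tychonoff_space (subtopology B S)"
  using assms unfolding stone_cech_def tychonoff_space_def
  by (simp add: Hausdorff_space_subtopology completely_regular_space_subtopology
      compact_Hausdorff_or_regular_imp_normal_space normal_imp_completely_regular_space)

section \<open>The hull of points with evaluations continuous on compact sets\<close>

text \<open>The points \<open>y\<close> of \<open>\<beta>X\<close> for which \<open>f \<mapsto> f\<^sup>\<beta>(y)\<close> is continuous on each compact subset of
  \<open>C\<^sub>p\<^sup>b(X)\<close>. By \<open>kappa_completion_eq_kappa_hull\<close> they form the \<open>\<kappa>\<close>-completion of \<open>X\<close>.\<close>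

definition kappa_hull :: "'a topology \<Rightarrow> 'a topology \<Rightarrow> 'a set" where
  "kappa_hull B X = {y \<in> topspace B. \<forall>K. compactin (Cpb X) K \<longrightarrow>
      continuous_map (subtopology (Cpb X) K) euclideanreal (\<lambda>f. stone_ext B X f y)}"

lemma kappa_hull_subset_topspace: "kappa_hull B X \<subseteq> topspace B"
  by (auto simp: kappa_hull_def)

lemma topspace_subset_kappa_hull:
  assumes B: "stone_cech B X"
  shows "topspace X \<subseteq> kappa_hull B X"
proof
  fix x assume x: "x \<in> topspace X"
  have "continuous_map (subtopology (Cpb X) K) euclideanreal (\<lambda>f. stone_ext B X f x)" for K
    using continuous_map_from_subtopology[OF continuous_map_Cpb_eval[OF x]]
    by (rule continuous_map_eq) (simp add: stone_ext_eq[OF B _ x])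
  then show "x \<in> kappa_hull B X"
    using x stone_cech_topspace_subset[OF B] by (auto simp: kappa_hull_def)
qed

text \<open>This is where compact subsets of \<open>C\<^sub>p\<^sup>b(X)\<close> force the points of the hull to lie in the
  realcompactification: a zero of \<open>g\<^sup>\<beta>\<close> would make evaluation discontinuous on a convergent
  sequence.\<close>

lemma stone_ext_pos:
  assumes B: "stone_cech B X" and y: "y \<in> kappa_hull B X" and g: "g \<in> topspace (Cpb X)"
    and pos: "\<And>x. x \<in> topspace X \<Longrightarrow> 0 < g x"
  shows "0 < stone_ext B X g y"
proof (rule ccontr)
  have yB: "y \<in> topspace B"
    using kappa_hull_subset_topspace y by (rule subsetD)
  assume "\<not> 0 < stone_ext B X g y"
  moreover have "0 \<le> stone_ext B X g y"
    using B g pos yB by (intro stone_ext_nonneg) (auto intro: less_imp_le)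
  ultimately have gy: "stone_ext B X g y = 0" by simp
  define z where "z = (\<lambda>x\<in>topspace X. 0::real)"
  define f where "f n = (\<lambda>x\<in>topspace X. max 0 (1 - real n * g x))" for n
  have z: "z \<in> topspace (Cpb X)"
    unfolding z_def by (rule restrict_in_Cpb) (auto intro: finite_imp_bounded finite_subset[of _ "{0}"])
  have gc: "continuous_map X euclideanreal g"
    using g by (simp add: topspace_Cpb)
  have f: "f n \<in> topspace (Cpb X)" for n
    unfolding f_def
  proof (rule restrict_in_Cpb)
    show "continuous_map X euclideanreal (\<lambda>x. max 0 (1 - real n * g x))"
      by (intro continuous_intros gc)
    have "max 0 (1 - real n * g x) \<in> {0..1}" if "x \<in> topspace X" for x
      using less_imp_le[OF pos[OF that]] by simp
    then show "bounded ((\<lambda>x. max 0 (1 - real n * g x)) ` topspace X)"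
      by (intro bounded_subset[OF bounded_closed_interval[of 0 1]]) blast
  qed
  have fy: "stone_ext B X (f n) y = 1" for n
  proof -
    have "continuous_map B euclideanreal (\<lambda>x. max 0 (1 - real n * stone_ext B X g x))"
      by (intro continuous_intros continuous_map_stone_ext[OF B g])
    then have "stone_ext B X (f n) y = max 0 (1 - real n * stone_ext B X g y)"
      by (rule stone_ext_unique_B[OF B f _ _ yB]) (simp add: f_def stone_ext_eq[OF B g])
    then show ?thesis by (simp add: gy)
  qed
  have zy: "stone_ext B X z y = 0"
    by (rule stone_ext_unique_B[OF B z _ _ yB]) (simp_all add: z_def)
  have lim: "limitin (Cpb X) f z sequentially"
    unfolding Cpb_def limitin_subtopology
  proof (intro conjI)
    show "z \<in> {f. bounded (f ` topspace X)}" "\<forall>\<^sub>F n in sequentially. f n \<in> {f. bounded (f ` topspace X)}"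
      using f z by (simp_all add: topspace_Cpb)
    show "limitin (Cp X) f z sequentially"
    proof (rule limitin_Cp)
      fix x assume x: "x \<in> topspace X"
      have "\<forall>\<^sub>F n in sequentially. 1 / g x < real n"
        using filterlim_real_sequentially by (simp add: filterlim_at_top_dense)
      then have "\<forall>\<^sub>F n in sequentially. f n x = z x"
        by eventually_elim (use pos[OF x] x in \<open>simp add: f_def z_def field_simps\<close>)
      then show "limitin euclideanreal (\<lambda>n. f n x) (z x) sequentially"
        unfolding limitin_canonical_iff by (rule tendsto_eventually)
    qed (use f z in \<open>simp_all add: topspace_Cp topspace_Cpb\<close>)
  qed
  define K where "K = insert z (range f)"
  have "compactin (Cpb X) K"
    unfolding K_def by (rule compactin_sequence_with_limit[OF lim]) (use f in auto)
  then have "continuous_map (subtopology (Cpb X) K) euclideanreal (\<lambda>f. stone_ext B X f y)"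
    using y by (simp add: kappa_hull_def)
  moreover have "limitin (subtopology (Cpb X) K) f z sequentially"
    using lim by (simp add: limitin_subtopology K_def)
  ultimately have "limitin euclideanreal (\<lambda>n. stone_ext B X (f n) y) (stone_ext B X z y) sequentially"
    by (auto dest: continuous_map_limit simp: o_def)
  then show False
    by (simp add: fy zy LIMSEQ_const_iff)
qed

section \<open>Extending unbounded functions to the hull\<close>

text \<open>The bounded function \<open>arctan f\<close> as an element of \<open>C\<^sub>p\<^sup>b(X)\<close>.\<close>

definition arctan_fun :: "'a topology \<Rightarrow> ('a \<Rightarrow> real) \<Rightarrow> 'a \<Rightarrow> real" where
  "arctan_fun X f = (\<lambda>x\<in>topspace X. arctan (f x))"

text \<open>The extension of a possibly unbounded \<open>f \<in> C\<^sub>p(X)\<close>. It is meaningful on \<open>kappa_hull B X\<close>, where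
  \<open>(arctan f)\<^sup>\<beta>\<close> stays inside the open interval \<open>(-\<pi>/2, \<pi>/2)\<close>.\<close>

definition real_ext :: "'a topology \<Rightarrow> 'a topology \<Rightarrow> ('a \<Rightarrow> real) \<Rightarrow> 'a \<Rightarrow> real" where
  "real_ext B X f y = tan (stone_ext B X (arctan_fun X f) y)"

lemma continuous_map_arctan:
  "continuous_map X euclideanreal f \<Longrightarrow> continuous_map X euclideanreal (\<lambda>x. arctan (f x))"
  using continuous_map_compose[of X euclideanreal f euclideanreal arctan] continuous_on_arctan[of UNIV "\<lambda>x. x"]
  by (simp add: o_def)

lemma arctan_bounds: "arctan x \<in> {-(pi/2)..pi/2}"
  using arctan_lbound[of x] arctan_ubound[of x] by (simp add: less_imp_le)

lemma arctan_fun_in_Cpb: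
  assumes "f \<in> topspace (Cp X)"
  shows "arctan_fun X f \<in> topspace (Cpb X)"
  unfolding arctan_fun_def
proof (rule restrict_in_Cpb)
  show "continuous_map X euclideanreal (\<lambda>x. arctan (f x))"
    using assms by (intro continuous_map_arctan) (simp add: topspace_Cp)
  show "bounded ((\<lambda>x. arctan (f x)) ` topspace X)"
    using arctan_bounds by (intro bounded_subset[OF bounded_closed_interval[of "-(pi/2)" "pi/2"]]) blast
qed

lemma continuous_map_arctan_fun: "continuous_map (Cp X) (Cpb X) (arctan_fun X)"
  by (rule continuous_map_into_Cpb[OF arctan_fun_in_Cpb])
    (simp_all add: arctan_fun_def continuous_map_arctan continuous_map_Cp_eval)

lemma stone_ext_arctan_bounds:
  assumes B: "stone_cech B X" and y: "y \<in> kappa_hull B X" and f: "f \<in> topspace (Cp X)"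
  shows "stone_ext B X (arctan_fun X f) y \<in> {-(pi/2)<..<pi/2}"
proof -
  have yB: "y \<in> topspace B"
    using kappa_hull_subset_topspace y by (rule subsetD)
  \<comment> \<open>Both bounds come from positivity, applied to \<open>\<pi>/2 + arctan f\<close> and \<open>\<pi>/2 - arctan f\<close>.\<close>
  have "0 < pi/2 + s * stone_ext B X (arctan_fun X f) y" if s: "s \<in> {-1, 1}" for s
  proof -
    define g where "g = (\<lambda>x\<in>topspace X. pi/2 + s * arctan (f x))"
    have "pi/2 + s * arctan (f x) \<in> {0..pi}" for x
      using arctan_bounds[of "f x"] s by auto
    then have "bounded ((\<lambda>x. pi/2 + s * arctan (f x)) ` topspace X)"
      by (intro bounded_subset[OF bounded_closed_interval[of 0 pi]]) blast
    moreover have "continuous_map X euclideanreal (\<lambda>x. pi/2 + s * arctan (f x))"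
      using f by (intro continuous_intros continuous_map_arctan) (simp_all add: topspace_Cp)
    ultimately have g: "g \<in> topspace (Cpb X)"
      unfolding g_def by (intro restrict_in_Cpb)
    have "0 < g x" if "x \<in> topspace X" for x
      using that s arctan_lbound[of "f x"] arctan_ubound[of "f x"] by (auto simp: g_def)
    then have "0 < stone_ext B X g y"
      using stone_ext_pos[OF B y g] by blast
    moreover have "continuous_map B euclideanreal (\<lambda>x. pi/2 + s * stone_ext B X (arctan_fun X f) x)"
      by (intro continuous_intros continuous_map_stone_ext[OF B arctan_fun_in_Cpb[OF f]]) simp_all
    then have "stone_ext B X g y = pi/2 + s * stone_ext B X (arctan_fun X f) y"
      by (rule stone_ext_unique_B[OF B g _ _ yB])
        (use stone_ext_eq[OF B arctan_fun_in_Cpb[OF f]] in \<open>simp add: g_def arctan_fun_def\<close>)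
    ultimately show ?thesis by simp
  qed
  from this[of 1] this[of "-1"] show ?thesis by simp
qed

lemma real_ext_eq:
  assumes "stone_cech B X" "f \<in> topspace (Cp X)" "x \<in> topspace X"
  shows "real_ext B X f x = f x"
  using stone_ext_eq[OF assms(1) arctan_fun_in_Cpb[OF assms(2)] assms(3)] assms(3)
  by (simp add: real_ext_def arctan_fun_def tan_arctan)

lemma continuous_map_tan:
  assumes "continuous_map X euclideanreal u" "\<And>x. x \<in> topspace X \<Longrightarrow> u x \<in> {-(pi/2)<..<pi/2}"
  shows "continuous_map X euclideanreal (\<lambda>x. tan (u x))"
proof -
  have "continuous_on {-(pi/2)<..<pi/2} tan"
    by (intro continuous_at_imp_continuous_on ballI isCont_tan)
      (auto intro!: less_imp_neq[symmetric] cos_gt_zero_pi)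
  moreover have "continuous_map X (top_of_set {-(pi/2)<..<pi/2}) u"
    using assms by (auto simp: continuous_map_in_subtopology)
  ultimately show ?thesis
    using continuous_map_compose[of X "top_of_set {-(pi/2)<..<pi/2}" u euclideanreal tan]
    by (simp add: o_def)
qed

lemma real_ext_continuous_on_hull:
  assumes B: "stone_cech B X" and f: "f \<in> topspace (Cp X)" and S: "S \<subseteq> kappa_hull B X"
  shows "continuous_map (subtopology B S) euclideanreal (real_ext B X f)"
  unfolding real_ext_def
  using continuous_map_stone_ext[OF B arctan_fun_in_Cpb[OF f]] stone_ext_arctan_bounds[OF B _ f] S
  by (intro continuous_map_tan continuous_map_from_subtopology) auto

lemma real_ext_continuous_on_compact:
  assumes B: "stone_cech B X" and y: "y \<in> kappa_hull B X" and K: "compactin (Cp X) K"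
  shows "continuous_map (subtopology (Cp X) K) euclideanreal (\<lambda>f. real_ext B X f y)"
  unfolding real_ext_def
proof (rule continuous_map_tan)
  let ?L = "arctan_fun X ` K"
  have "compactin (Cpb X) ?L"
    using K continuous_map_arctan_fun by (rule image_compactin)
  then have "continuous_map (subtopology (Cpb X) ?L) euclideanreal (\<lambda>f. stone_ext B X f y)"
    using y by (simp add: kappa_hull_def)
  moreover have "continuous_map (subtopology (Cp X) K) (subtopology (Cpb X) ?L) (arctan_fun X)"
    using continuous_map_from_subtopology[OF continuous_map_arctan_fun]
    by (auto simp: continuous_map_in_subtopology)
  ultimately have "continuous_map (subtopology (Cp X) K) euclideanreal
      ((\<lambda>f. stone_ext B X f y) \<circ> arctan_fun X)"
    by (rule continuous_map_compose[rotated])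
  then show "continuous_map (subtopology (Cp X) K) euclideanreal
      (\<lambda>f. stone_ext B X (arctan_fun X f) y)"
    by (simp add: o_def)
qed (use stone_ext_arctan_bounds[OF B y] in auto)

section \<open>The hull is the \<open>\<kappa>\<close>-completion\<close>

lemma kappa_space_kappa_hull:
  assumes B: "stone_cech B X"
  shows "kappa_space (subtopology B (kappa_hull B X))"
proof -
  define W where "W = sum_topology (subtopology (Cpb X)) {K. compactin (Cpb X) K}"
  define P where "P = product_topology (\<lambda>_. euclideanreal) (topspace W)"
  define e where "e y = (\<lambda>w\<in>topspace W. stone_ext B X (snd w) y)" for y
  have W: "locally_compact_space W" "Hausdorff_space W"
    unfolding W_def
    by (simp_all add: compact_imp_locally_compact_space compact_space_subtopology
        locally_compact_space_sum_topology Hausdorff_space_sum_topology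
        Hausdorff_space_subtopology Hausdorff_space_Cpb)
  have tW: "w \<in> topspace W \<longleftrightarrow> compactin (Cpb X) (fst w) \<and> snd w \<in> fst w" for w
    using compactin_subset_topspace by (cases w) (fastforce simp: W_def)
  have snd_W: "snd w \<in> topspace (Cpb X)" if "w \<in> topspace W" for w
    using that tW compactin_subset_topspace by blast
  have singleton_W: "({f}, f) \<in> topspace W" if "f \<in> topspace (Cpb X)" for f
    using that by (simp add: tW)
  have e_cont: "continuous_map B P e"
    unfolding P_def continuous_map_componentwise
    using continuous_map_stone_ext[OF B snd_W] by (auto simp: e_def)
  have e_inj: "inj_on e (topspace B)"
  proof (rule inj_onI, rule ccontr)
    fix a b assume ab: "a \<in> topspace B" "b \<in> topspace B" "e a = e b" "a \<noteq> b"
    have "tychonoff_space B"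
      using stone_cech_tychonoff[OF B, of "topspace B"] by simp
    moreover have "closedin B {b}"
      using ab B by (simp add: stone_cech_def closedin_Hausdorff_sing_eq)
    ultimately obtain g where g: "continuous_map B (top_of_set {0..1::real}) g" "g a = 0" "g b = 1"
      using ab unfolding tychonoff_space_def completely_regular_space_def by blast
    define f where "f = restrict g (topspace X)"
    have gc: "continuous_map B euclideanreal g" and g01: "g x \<in> {0..1}" if "x \<in> topspace B" for x
      using g that by (auto simp: continuous_map_in_subtopology)
    have "continuous_map X euclideanreal g"
      using gc[OF ab(1)] B unfolding stone_cech_def by (metis continuous_map_from_subtopology)
    moreover have "bounded (g ` topspace X)"
      using g01 stone_cech_topspace_subset[OF B]
      by (intro bounded_subset[OF bounded_closed_interval[of 0 1]]) blast
    ultimately have f: "f \<in> topspace (Cpb X)"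
      unfolding f_def by (rule restrict_in_Cpb)
    have "stone_ext B X f x = g x" if "x \<in> topspace B" for x
      by (rule stone_ext_unique_B[OF B f gc[OF that] _ that]) (simp add: f_def)
    moreover have "e a ({f}, f) = e b ({f}, f)"
      using ab by simp
    ultimately show False
      using singleton_W[OF f] ab g by (simp add: e_def)
  qed
  \<comment> \<open>Closedness in \<open>C\<^sub>p(W)\<close> is inherited from the compact image of all of \<open>B\<close> in \<open>\<real>\<^sup>W\<close>.\<close>
  have e_emb: "embedding_map B P e"
    using e_cont _ e_inj
  proof (rule injective_closed_imp_embedding_map)
    show "closed_map B P e"
      using e_cont B unfolding P_def stone_cech_def
      by (intro continuous_imp_closed_map) (auto simp: Hausdorff_space_product_topology)
  qed
  \<comment> \<open>\<open>W\<close> is a sum, so \<open>e y\<close> is continuous iff it is so on each summand, a compact set of functions.\<close>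
  have hull_iff: "y \<in> kappa_hull B X \<longleftrightarrow> continuous_map W euclideanreal (e y)"
    if y: "y \<in> topspace B" for y
  proof -
    have e_ext: "stone_ext B X (snd w) y = e y w" if "w \<in> topspace W" for w
      using that by (simp add: e_def)
    show ?thesis
    proof
      assume "y \<in> kappa_hull B X"
      then have "continuous_map W euclideanreal (\<lambda>w. stone_ext B X (snd w) y)"
        unfolding W_def by (intro continuous_map_from_sum_topology) (auto simp: kappa_hull_def)
      then show "continuous_map W euclideanreal (e y)"
        by (rule continuous_map_eq) (rule e_ext)
    next
      assume "continuous_map W euclideanreal (e y)"
      then have c: "continuous_map W euclideanreal (\<lambda>w. stone_ext B X (snd w) y)"
        by (rule continuous_map_eq) (simp add: e_ext)
      have "continuous_map (subtopology (Cpb X) K) euclideanreal (\<lambda>f. stone_ext B X f y)"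
        if "compactin (Cpb X) K" for K
      proof -
        have "continuous_map (subtopology (Cpb X) K) W (Pair K)"
          unfolding W_def using that by (intro continuous_map_component_injection) simp
        from continuous_map_compose[OF this c] show ?thesis
          by (simp add: o_def)
      qed
      then show "y \<in> kappa_hull B X"
        using y by (simp add: kappa_hull_def)
    qed
  qed
  have "kappa_hull B X = {y \<in> topspace B. continuous_map W euclideanreal (e y)}"
    using hull_iff subsetD[OF kappa_hull_subset_topspace[of B X]] by blast
  then have image: "e ` kappa_hull B X = e ` topspace B \<inter> {g. continuous_map W euclideanreal g}"
    by auto
  have "closedin P (e ` topspace B)"
    using e_cont B unfolding stone_cech_def P_def
    by (intro compactin_imp_closedin image_compactin[of B])
      (auto simp: Hausdorff_space_product_topology compact_space_def)
  then have closed: "closedin (Cp W) (e ` kappa_hull B X)"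
    unfolding Cp_def image closedin_subtopology P_def by blast
  have "homeomorphic_map (subtopology B (kappa_hull B X))
      (subtopology (subtopology P (e ` topspace B)) (e ` kappa_hull B X)) e"
  proof (rule homeomorphic_map_subtopologies)
    show "homeomorphic_map B (subtopology P (e ` topspace B)) e"
      using e_emb by (simp add: embedding_map_def)
    have "topspace B \<inter> kappa_hull B X = kappa_hull B X"
      using kappa_hull_subset_topspace by (rule inf.absorb2)
    moreover have "e ` topspace B \<subseteq> topspace P"
      using e_cont by (auto simp: continuous_map_def)
    ultimately show "e ` (topspace B \<inter> kappa_hull B X)
        = topspace (subtopology P (e ` topspace B)) \<inter> e ` kappa_hull B X"
      using image by auto
  qed
  moreover have "subtopology (subtopology P (e ` topspace B)) (e ` kappa_hull B X)
      = subtopology (Cp W) (e ` kappa_hull B X)"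
    unfolding Cp_def P_def subtopology_subtopology image
    by (intro arg_cong2[where f = subtopology] refl) blast
  ultimately have "subtopology B (kappa_hull B X) homeomorphic_space subtopology (Cp W) (e ` kappa_hull B X)"
    using homeomorphic_map_imp_homeomorphic_space by metis
  then show ?thesis
    using kappa_spaceI[OF stone_cech_tychonoff[OF B] W closed] by blast
qed

lemma kappa_hull_subset:
  assumes B: "stone_cech B X" and A: "topspace X \<subseteq> A" "A \<subseteq> topspace B"
    and kappa: "kappa_space (subtopology B A)"
  shows "kappa_hull B X \<subseteq> A"
proof
  obtain Z :: "(('a \<Rightarrow> real) set \<times> ('a \<Rightarrow> real)) topology" and C \<phi> \<psi>
    where Z: "locally_compact_space Z" and C: "closedin (Cp Z) C"
      and hm: "homeomorphic_maps (subtopology B A) (subtopology (Cp Z) C) \<phi> \<psi>"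
    using kappa unfolding kappa_space_def homeomorphic_space_def by blast
  define H where "H = kappa_hull B X"
  have topA: "topspace (subtopology B A) = A"
    using A by auto
  have XB: "X = subtopology B (topspace X)"
    using B by (simp add: stone_cech_def)
  have HB: "H \<subseteq> topspace B" and XH: "topspace X \<subseteq> H"
    unfolding H_def by (rule kappa_hull_subset_topspace, rule topspace_subset_kappa_hull[OF B])
  have \<phi>: "continuous_map (subtopology B A) (Cp Z) \<phi>" and \<phi>C: "\<And>x. x \<in> A \<Longrightarrow> \<phi> x \<in> C"
    and \<psi>: "continuous_map (subtopology (Cp Z) C) B \<psi>" and \<psi>A: "\<And>c. c \<in> C \<Longrightarrow> \<psi> c \<in> A"
    and \<psi>\<phi>: "\<And>x. x \<in> A \<Longrightarrow> \<psi> (\<phi> x) = x"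
    using hm topA closedin_subset[OF C]
    by (auto simp: homeomorphic_maps_def continuous_map_in_subtopology inf.absorb2)
  have \<phi>X: "continuous_map X (Cp Z) \<phi>"
    using continuous_map_from_subtopology_mono[OF \<phi> A(1)] XB by simp
  \<comment> \<open>The transpose of \<open>\<phi>\<close> restricted to \<open>X\<close>.\<close>
  define h where "h z = (\<lambda>x\<in>topspace X. \<phi> x z)" for z
  have h_in: "h z \<in> topspace (Cp X)" if "z \<in> topspace Z" for z
    unfolding h_def
    using continuous_map_compose[OF \<phi>X continuous_map_Cp_eval[OF that]]
    by (intro restrict_in_Cp) (simp add: o_def)
  have h_cont: "continuous_map Z (Cp X) h"
  proof (rule continuous_map_into_Cp[OF h_in])
    fix x assume x: "x \<in> topspace X"
    then have "\<phi> x \<in> topspace (Cp Z)"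
      using \<phi>X by (auto simp: continuous_map_def)
    then show "continuous_map Z euclideanreal (\<lambda>z. h z x)"
      using x by (simp add: h_def topspace_Cp)
  qed
  \<comment> \<open>The extension of \<open>\<phi>\<close> from \<open>X\<close> to the hull, taken coordinatewise.\<close>
  define \<Phi> where "\<Phi> y = (\<lambda>z\<in>topspace Z. real_ext B X (h z) y)" for y
  have \<Phi>_in: "\<Phi> y \<in> topspace (Cp Z)" if y: "y \<in> H" for y
    unfolding \<Phi>_def
  proof (rule restrict_in_Cp[OF continuous_map_from_k_space[OF locally_compact_imp_k_space[OF Z]]])
    fix Q assume "compactin Z Q"
    then have "compactin (Cp X) (h ` Q)"
      using h_cont by (rule image_compactin)
    then have "continuous_map (subtopology (Cp X) (h ` Q)) euclideanreal (\<lambda>f. real_ext B X f y)"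
      using y unfolding H_def by (intro real_ext_continuous_on_compact[OF B])
    moreover have "continuous_map (subtopology Z Q) (subtopology (Cp X) (h ` Q)) h"
      using continuous_map_from_subtopology[OF h_cont] by (auto simp: continuous_map_in_subtopology)
    ultimately have "continuous_map (subtopology Z Q) euclideanreal ((\<lambda>f. real_ext B X f y) \<circ> h)"
      by (rule continuous_map_compose[rotated])
    then show "continuous_map (subtopology Z Q) euclideanreal (\<lambda>z. real_ext B X (h z) y)"
      by (simp add: o_def)
  qed
  have \<Phi>_cont: "continuous_map (subtopology B H) (Cp Z) \<Phi>"
  proof (rule continuous_map_into_Cp)
    fix z assume z: "z \<in> topspace Z"
    then show "continuous_map (subtopology B H) euclideanreal (\<lambda>y. \<Phi> y z)"
      using real_ext_continuous_on_hull[OF B h_in[OF z], of H] by (simp add: \<Phi>_def H_def)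
  qed (use \<Phi>_in in auto)
  have \<Phi>X: "\<Phi> x = \<phi> x" if x: "x \<in> topspace X" for x
  proof -
    have "\<phi> x \<in> extensional (topspace Z)"
      using \<phi>X x by (auto simp: continuous_map_def topspace_Cp)
    then show ?thesis
      using x h_in
      by (intro extensionalityI[of _ "topspace Z"]) (auto simp: \<Phi>_def real_ext_eq[OF B] h_def)
  qed
  have dense: "subtopology B H closure_of topspace X = H"
    using B XH HB unfolding stone_cech_def closure_of_subtopology by (simp add: inf.absorb2 inf.absorb1)
  have "\<Phi> ` H \<subseteq> Cp Z closure_of (\<Phi> ` topspace X)"
    using continuous_map_image_closure_subset[OF \<Phi>_cont, of "topspace X"] dense by simp
  also have "\<dots> \<subseteq> C"
    using C \<phi>C A(1) \<Phi>X by (intro closure_of_minimal) auto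
  finally have \<Phi>C: "\<Phi> ` H \<subseteq> C" .
  then have "continuous_map (subtopology B H) (subtopology (Cp Z) C) \<Phi>"
    using \<Phi>_cont HB by (auto simp: continuous_map_in_subtopology)
  then have \<psi>\<Phi>: "continuous_map (subtopology B H) B (\<psi> \<circ> \<Phi>)"
    using \<psi> by (rule continuous_map_compose)
  fix y assume "y \<in> kappa_hull B X"
  then have y: "y \<in> H" by (simp add: H_def)
  have "(\<psi> \<circ> \<Phi>) y = id y"
  proof (rule forall_in_closure_of_eq[where X = "subtopology B H" and Y = B and S = "topspace X"
        and f = "\<psi> \<circ> \<Phi>" and g = id and x = y])
    show "(\<psi> \<circ> \<Phi>) x = id x" if "x \<in> topspace X" for x
      using that A(1) by (auto simp: \<Phi>X \<psi>\<phi>)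
  qed (use y dense \<psi>\<Phi> B in \<open>auto simp: stone_cech_def continuous_map_from_subtopology\<close>)
  then show "y \<in> A"
    using \<psi>A \<Phi>C y by (metis comp_apply id_apply image_subset_iff)
qed

lemma kappa_completion_eq_kappa_hull:
  assumes "stone_cech B X"
  shows "kappa_completion B X = kappa_hull B X"
  unfolding kappa_completion_def
  using kappa_hull_subset[OF assms] kappa_space_kappa_hull[OF assms]
    topspace_subset_kappa_hull[OF assms] kappa_hull_subset_topspace[of B X]
  by blast

section \<open>Compact sets of functions\<close>

lemma continuous_map_restrict_Cp:
  assumes "X = subtopology Y (topspace X)"
  shows "continuous_map (Cp Y) (Cp X) (\<lambda>f. restrict f (topspace X))"
proof (rule continuous_map_into_Cp)
  fix f assume "f \<in> topspace (Cp Y)"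
  then have "continuous_map (subtopology Y (topspace X)) euclideanreal f"
    by (simp add: topspace_Cp continuous_map_from_subtopology)
  then show "restrict f (topspace X) \<in> topspace (Cp X)"
    unfolding assms[symmetric] by (rule restrict_in_Cp)
next
  have "topspace X \<subseteq> topspace Y"
    using assms by (metis inf_le1 topspace_subtopology)
  then show "continuous_map (Cp Y) euclideanreal (\<lambda>f. restrict f (topspace X) x)"
    if "x \<in> topspace X" for x
    using that continuous_map_Cp_eval[of x Y] by auto
qed

lemma compactin_restrict_Cp:
  assumes "X = subtopology Y (topspace X)" "compactin (Cp Y) K"
  shows "compactin (Cp X) ((\<lambda>f. restrict f (topspace X)) ` K)"
  using assms(2) continuous_map_restrict_Cp[OF assms(1)] by (rule image_compactin)

lemma compactin_restrict_Cpb: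
  assumes "X = subtopology Y (topspace X)" "compactin (Cpb Y) K"
  shows "compactin (Cpb X) ((\<lambda>f. restrict f (topspace X)) ` K)"
proof -
  have "topspace X \<subseteq> topspace Y"
    using assms(1) by (metis inf_le1 topspace_subtopology)
  then have "bounded (restrict f (topspace X) ` topspace X)" if "f \<in> K" for f
    using assms(2) that unfolding compactin_Cpb image_restrict_eq
    by (meson bounded_subset image_mono)
  then show ?thesis
    using assms compactin_restrict_Cp unfolding compactin_Cpb by blast
qed

lemma bounded_image_dense:
  assumes f: "continuous_map Y euclideanreal f" and dense: "Y closure_of S = topspace Y"
    and "bounded (f ` S)"
  shows "bounded (f ` topspace Y)"
proof -
  have "f ` topspace Y \<subseteq> closure (f ` S)"
    using continuous_map_image_closure_subset[OF f, of S] dense by simp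
  then show ?thesis
    using assms(3) bounded_closure bounded_subset by blast
qed

lemma same_compact_Cp_if_subset_hull:
  assumes B: "stone_cech B X" and X: "X = subtopology Y (topspace X)"
    and Y: "Y = subtopology B (topspace Y)" and hull: "topspace Y \<subseteq> kappa_hull B X"
  shows "same_compact_subsets (topspace X) (Cp Y) (Cp X)"
proof -
  have XY: "topspace X \<subseteq> topspace Y"
    using X by (metis inf_le1 topspace_subtopology)
  have "\<exists>L. compactin (Cp Y) L \<and> K = (\<lambda>f. restrict f (topspace X)) ` L"
    if K: "compactin (Cp X) K" for K
  proof -
    define E where "E f = restrict (real_ext B X f) (topspace Y)" for f
    have KX: "f \<in> topspace (Cp X)" if "f \<in> K" for f
      using that K compactin_subset_topspace by blast
    have "continuous_map (subtopology (Cp X) K) (Cp Y) E"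
    proof (rule continuous_map_into_Cp)
      fix f assume "f \<in> topspace (subtopology (Cp X) K)"
      then show "E f \<in> topspace (Cp Y)"
        unfolding E_def using real_ext_continuous_on_hull[OF B _ hull] Y
        by (intro restrict_in_Cp) simp
    next
      fix y assume "y \<in> topspace Y"
      then show "continuous_map (subtopology (Cp X) K) euclideanreal (\<lambda>f. E f y)"
        using real_ext_continuous_on_compact[OF B _ K, of y] hull by (auto simp: E_def)
    qed
    then have "compactin (Cp Y) (E ` K)"
      using K by (intro image_compactin[of "subtopology (Cp X) K"]) (simp_all add: compactin_subtopology)
    moreover have "restrict (E f) (topspace X) = f" if "f \<in> K" for f
      using KX[OF that] XY
      by (intro extensionalityI[of _ "topspace X"]) (auto simp: E_def real_ext_eq[OF B] topspace_Cp)
    then have "K = (\<lambda>f. restrict f (topspace X)) ` E ` K"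
      by (simp add: image_image)
    ultimately show ?thesis by blast
  qed
  then show ?thesis
    unfolding same_compact_subsets_def using compactin_restrict_Cp[OF X] by blast
qed

lemma same_compact_Cpb_if_Cp:
  assumes X: "X = subtopology Y (topspace X)" and dense: "Y closure_of topspace X = topspace Y"
    and same: "same_compact_subsets (topspace X) (Cp Y) (Cp X)"
  shows "same_compact_subsets (topspace X) (Cpb Y) (Cpb X)"
proof -
  have "\<exists>L. compactin (Cpb Y) L \<and> K = (\<lambda>f. restrict f (topspace X)) ` L"
    if K: "compactin (Cpb X) K" for K
  proof -
    obtain L where L: "compactin (Cp Y) L" "K = (\<lambda>f. restrict f (topspace X)) ` L"
      using K same unfolding same_compact_subsets_def compactin_Cpb by blast
    have "bounded (f ` topspace Y)" if "f \<in> L" for f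
    proof (rule bounded_image_dense[OF _ dense])
      show "continuous_map Y euclideanreal f"
        using L(1) that compactin_subset_topspace topspace_Cp by blast
      show "bounded (f ` topspace X)"
        using K L(2) that by (auto simp: compactin_Cpb image_restrict_eq)
    qed
    then show ?thesis
      using L compactin_Cpb by blast
  qed
  then show ?thesis
    unfolding same_compact_subsets_def using compactin_restrict_Cpb[OF X] by blast
qed

lemma subset_hull_if_same_compact_Cpb:
  assumes B: "stone_cech B X" and X: "X = subtopology Y (topspace X)"
    and Y: "Y = subtopology B (topspace Y)"
    and same: "same_compact_subsets (topspace X) (Cpb Y) (Cpb X)"
  shows "topspace Y \<subseteq> kappa_hull B X"
proof
  fix y assume y: "y \<in> topspace Y"
  have XY: "topspace X \<subseteq> topspace Y" and YB: "topspace Y \<subseteq> topspace B"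
    using X Y by (metis inf_le1 topspace_subtopology)+
  let ?r = "\<lambda>f::'a \<Rightarrow> real. restrict f (topspace X)"
  have "continuous_map (subtopology (Cpb X) K) euclideanreal (\<lambda>f. stone_ext B X f y)"
    if K: "compactin (Cpb X) K" for K
  proof -
    obtain L where L: "compactin (Cpb Y) L" "K = ?r ` L"
      using K same unfolding same_compact_subsets_def by blast
    have KX: "f \<in> topspace (Cpb X)" if "f \<in> K" for f
      using that K compactin_subset_topspace by blast
    have ext: "stone_ext B X (?r f) y = f y" if "f \<in> L" for f
    proof (rule stone_ext_unique[OF B KX XY YB _ _ y])
      show "?r f \<in> K"
        unfolding L(2) using that by (rule imageI)
      have "f \<in> topspace (Cpb Y)"
        using L(1) that compactin_subset_topspace by blast
      then show "continuous_map (subtopology B (topspace Y)) euclideanreal f"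
        using Y by (simp add: topspace_Cpb)
    qed simp
    have topL: "topspace (subtopology (Cpb Y) L) = L" and topK: "topspace (subtopology (Cpb X) K) = K"
      using L(1) K compactin_subset_topspace by auto
    have "continuous_map (subtopology (Cp Y) L) (Cp X) ?r"
      using continuous_map_from_subtopology[OF continuous_map_restrict_Cp[OF X]] .
    then have "continuous_map (subtopology (Cpb Y) L) (subtopology (Cpb X) K) ?r"
      unfolding Cpb_def subtopology_subtopology continuous_map_in_subtopology
      using L K by (auto simp: compactin_Cpb image_restrict_eq inf_commute
          intro: continuous_map_from_subtopology_mono)
    moreover have "compact_space (subtopology (Cpb Y) L)"
      using L(1) by (rule compact_space_subtopology)
    \<comment> \<open>A continuous surjection of a compact space onto a Hausdorff space is a quotient map, so
      continuity on \<open>K\<close> can be tested on \<open>L\<close>, where the evaluation is \<open>f \<mapsto> f y\<close>.\<close>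
    ultimately have q: "quotient_map (subtopology (Cpb Y) L) (subtopology (Cpb X) K) ?r"
      using topL topK L(2)
      by (intro continuous_imp_quotient_map) (auto simp: Hausdorff_space_subtopology Hausdorff_space_Cpb)
    have "continuous_map (subtopology (Cpb Y) L) euclideanreal ((\<lambda>f. stone_ext B X f y) \<circ> ?r)"
      using continuous_map_from_subtopology[OF continuous_map_Cpb_eval[OF y]]
      by (rule continuous_map_eq) (use topL ext in auto)
    with q show ?thesis
      by (rule continuous_compose_quotient_map)
  qed
  then show "y \<in> kappa_hull B X"
    using y YB by (auto simp: kappa_hull_def)
qed

theorem theorem1p4:
  fixes X Y B :: "'a topology"
  assumes "tychonoff_space Y"
    and "X = subtopology Y (topspace X)"
    and "stone_cech B X"
    and "Y = subtopology B (topspace Y)"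
  shows "(same_compact_subsets (topspace X) (Cp Y) (Cp X)
            \<longleftrightarrow> same_compact_subsets (topspace X) (Cpb Y) (Cpb X))
       \<and> (same_compact_subsets (topspace X) (Cpb Y) (Cpb X)
            \<longleftrightarrow> topspace Y \<subseteq> kappa_completion B X)"
proof -
  have "topspace X \<subseteq> topspace Y" and "topspace Y \<subseteq> topspace B"
    using assms(2,4) by (metis inf_le1 topspace_subtopology)+
  then have "subtopology B (topspace Y) closure_of topspace X = topspace (subtopology B (topspace Y))"
    using assms(3) unfolding stone_cech_def closure_of_subtopology
    by (simp add: inf.absorb1 inf.absorb2)
  then have "Y closure_of topspace X = topspace Y"
    using assms(4) by simp
  then show ?thesis
    using same_compact_Cp_if_subset_hull[OF assms(3,2,4)] same_compact_Cpb_if_Cp[OF assms(2)]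
      subset_hull_if_same_compact_Cpb[OF assms(3,2,4)] kappa_completion_eq_kappa_hull[OF assms(3)]
    by blast
qed

end
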